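(* Let $\mathbb{A}$ be a finite 3-conservative relational structure all of whose basic relations are unary or binary, and suppose $\mathbb{A}$ admits a Taylor operation. Then the variety generated by the algebra $(A,\mathrm{Pol}(\mathbb{A}))$ is congruence meet semidistributive ($SD(\wedge)$).
   Context: A relational structure $\mathbb{A}=(A,\{R_i\})$ is a set $A$ with relations $R_i\subseteq A^{n_i}$. An $n$-ary operation $f$ on $A$ preserves an $m$-ary relation $R$ if applying $f$ coordinatewise to any $n$ tuples of $R$ yields a tuple of $R$; $\mathrm{Pol}(\mathbb{A})$ is the set of all operations on $A$ preserving every basic relation of $\mathbb{A}$ (polymorphisms). $\mathbb{A}$ is 3-conservative if every subset of $A$ of size one, two or three is among its basic (unary) relations. An $n$-ary operation $t$ is Taylor if for every $1\le k\le n$ it satisfies some identity $t(u_1,\dots,u_{k-1},x,u_{k+1},\dots,u_n)\approx t(v_1,\dots,v_{k-1},y,v_{k+1},\dots,v_n)$ where the $u_i,v_i$ are variables and $x,y$ are distinct variables; $\mathbb{A}$ admits a Taylor operation if $\mathrm{Pol}(\mathbb{A})$ contains one. A variety is congruence meet semidistributive if for every algebra $\mathbf{B}$ in it and all congruences $\alpha,\beta,\gamma$ of $\mathbf{B}$, $\alpha\wedge\beta=\alpha\wedge\gamma$ implies $\alpha\wedge(\beta\vee\gamma)=\alpha\wedge\beta$. *)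

theory Defs
  imports "HOL-Library.FuncSet"
begin

section \<open>Operations and relational structures\<close>

definition tuples :: "nat \<Rightarrow> 'a set \<Rightarrow> 'a list set" where
  "tuples n X = {xs. length xs = n \<and> set xs \<subseteq> X}"

text \<open>
  An operation is a pair of its arity and a function on tuples. Operations on \<open>A\<close> are
  \<^const>\<open>undefined\<close> off the tuples over \<open>A\<close> of the right length, so two of them are
  equal iff they have the same arity and the same values.
\<close>

type_synonym 'a opn = "nat \<times> ('a list \<Rightarrow> 'a)"

definition operations :: "'a set \<Rightarrow> 'a opn set" where
  "operations A = {(n, f). f \<in> tuples n A \<rightarrow>\<^sub>E A}"

record ('i, 'a) rel_struct =
  dom :: "'a set"
  idx :: "'i set"
  rel_ar :: "'i \<Rightarrow> nat"
  rel :: "'i \<Rightarrow> 'a list set"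

definition is_rel_struct :: "('i, 'a) rel_struct \<Rightarrow> bool" where
  "is_rel_struct S \<longleftrightarrow> (\<forall>i \<in> idx S. rel S i \<subseteq> tuples (rel_ar S i) (dom S))"

definition preserves :: "'a opn \<Rightarrow> nat \<Rightarrow> 'a list set \<Rightarrow> bool" where
  "preserves g m R \<longleftrightarrow>
     (\<forall>ts \<in> tuples (fst g) R. map (\<lambda>j. snd g (map (\<lambda>t. t ! j) ts)) [0..<m] \<in> R)"

definition Pol :: "('i, 'a) rel_struct \<Rightarrow> 'a opn set" where
  "Pol S = {g \<in> operations (dom S). \<forall>i \<in> idx S. preserves g (rel_ar S i) (rel S i)}"

definition three_conservative :: "('i, 'a) rel_struct \<Rightarrow> bool" where
  "three_conservative S \<longleftrightarrow>
     (\<forall>X \<subseteq> dom S. card X \<in> {1, 2, 3} \<longrightarrow>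
        (\<exists>i \<in> idx S. rel_ar S i = 1 \<and> rel S i = (\<lambda>x. [x]) ` X))"

text \<open>
  Variables are natural numbers. The two sides of the \<open>k\<close>-th identity are given by their lists of
  variables, which must differ in position \<open>k\<close> (counted from zero) and are otherwise arbitrary.
\<close>

definition taylor_on :: "'a set \<Rightarrow> 'a opn \<Rightarrow> bool" where
  "taylor_on A t \<longleftrightarrow> 1 \<le> fst t \<and>
     (\<forall>k < fst t. \<exists>u v :: nat list. length u = fst t \<and> length v = fst t \<and> u ! k \<noteq> v ! k \<and>
        (\<forall>\<rho>. range \<rho> \<subseteq> A \<longrightarrow> snd t (map \<rho> u) = snd t (map \<rho> v)))"

definition admits_taylor :: "('i, 'a) rel_struct \<Rightarrow> bool" where
  "admits_taylor S \<longleftrightarrow> (\<exists>t \<in> Pol S. taylor_on (dom S) t)"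


section \<open>Algebras and varieties\<close>

record 'f signature =
  syms :: "'f set"
  ar :: "'f \<Rightarrow> nat"

record ('f, 'b) alg =
  univ :: "'b set"
  op :: "'f \<Rightarrow> 'b list \<Rightarrow> 'b"

definition is_algebra :: "'f signature \<Rightarrow> ('f, 'b) alg \<Rightarrow> bool" where
  "is_algebra \<Sigma> B \<longleftrightarrow> (\<forall>f \<in> syms \<Sigma>. \<forall>xs \<in> tuples (ar \<Sigma> f) (univ B). op B f xs \<in> univ B)"

datatype ('f, 'v) trm = Var 'v | App 'f "('f, 'v) trm list"

fun wf_trm :: "'f signature \<Rightarrow> ('f, 'v) trm \<Rightarrow> bool" where
  "wf_trm \<Sigma> (Var x) \<longleftrightarrow> True"
| "wf_trm \<Sigma> (App f ts) \<longleftrightarrow> f \<in> syms \<Sigma> \<and> length ts = ar \<Sigma> f \<and> (\<forall>t \<in> set ts. wf_trm \<Sigma> t)"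

fun trm_val :: "('f, 'b) alg \<Rightarrow> ('v \<Rightarrow> 'b) \<Rightarrow> ('f, 'v) trm \<Rightarrow> 'b" where
  "trm_val B \<rho> (Var x) = \<rho> x"
| "trm_val B \<rho> (App f ts) = op B f (map (trm_val B \<rho>) ts)"

definition satisfies_id :: "('f, 'b) alg \<Rightarrow> ('f, nat) trm \<Rightarrow> ('f, nat) trm \<Rightarrow> bool" where
  "satisfies_id B s t \<longleftrightarrow> (\<forall>\<rho>. range \<rho> \<subseteq> univ B \<longrightarrow> trm_val B \<rho> s = trm_val B \<rho> t)"

text \<open>
  The variety generated by an algebra consists of the models of all its identities. As the type
  \<open>'b\<close> of the elements of the member algebras is a parameter, this definition avoids any choice of
  types for powers; agreement with the closure under homomorphic images, subalgebras and powers is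
  shown at the end of this theory.
\<close>

definition generated_variety :: "'f signature \<Rightarrow> ('f, 'a) alg \<Rightarrow> ('f, 'b) alg set" where
  "generated_variety \<Sigma> Al =
     {B. is_algebra \<Sigma> B \<and>
         (\<forall>s t. wf_trm \<Sigma> s \<longrightarrow> wf_trm \<Sigma> t \<longrightarrow> satisfies_id Al s t \<longrightarrow> satisfies_id B s t)}"

definition congruences :: "'f signature \<Rightarrow> ('f, 'b) alg \<Rightarrow> ('b \<times> 'b) set set" where
  "congruences \<Sigma> B =
     {\<theta>. equiv (univ B) \<theta> \<and>
         (\<forall>f \<in> syms \<Sigma>. \<forall>xs \<in> tuples (ar \<Sigma> f) (univ B). \<forall>ys \<in> tuples (ar \<Sigma> f) (univ B).
            list_all2 (\<lambda>x y. (x, y) \<in> \<theta>) xs ys \<longrightarrow> (op B f xs, op B f ys) \<in> \<theta>)}"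

definition cong_join ::
  "'f signature \<Rightarrow> ('f, 'b) alg \<Rightarrow> ('b \<times> 'b) set \<Rightarrow> ('b \<times> 'b) set \<Rightarrow> ('b \<times> 'b) set" where
  "cong_join \<Sigma> B \<beta> \<gamma> = \<Inter>{\<theta> \<in> congruences \<Sigma> B. \<beta> \<union> \<gamma> \<subseteq> \<theta>}"

text \<open>The meet of two congruences is their intersection.\<close>

definition congruence_meet_semidistributive :: "'f signature \<Rightarrow> ('f, 'b) alg set \<Rightarrow> bool" where
  "congruence_meet_semidistributive \<Sigma> V \<longleftrightarrow>
     (\<forall>B \<in> V. \<forall>\<alpha> \<in> congruences \<Sigma> B. \<forall>\<beta> \<in> congruences \<Sigma> B. \<forall>\<gamma> \<in> congruences \<Sigma> B.
        \<alpha> \<inter> \<beta> = \<alpha> \<inter> \<gamma> \<longrightarrow> \<alpha> \<inter> cong_join \<Sigma> B \<beta> \<gamma> = \<alpha> \<inter> \<beta>)"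

text \<open>The algebra \<open>(A, Pol(S))\<close>: every polymorphism is a symbol that denotes itself.\<close>

definition pol_sig :: "('i, 'a) rel_struct \<Rightarrow> 'a opn signature" where
  "pol_sig S = \<lparr>syms = Pol S, ar = fst\<rparr>"

definition pol_alg :: "('i, 'a) rel_struct \<Rightarrow> ('a opn, 'a) alg" where
  "pol_alg S = \<lparr>univ = dom S, op = snd\<rparr>"

lemma is_algebra_pol_alg: "is_algebra (pol_sig S) (pol_alg S)"
  by (auto simp: is_algebra_def pol_sig_def pol_alg_def Pol_def operations_def)

lemma cong_join_in_congruences:
  assumes "is_algebra \<Sigma> B" "\<beta> \<in> congruences \<Sigma> B" "\<gamma> \<in> congruences \<Sigma> B"
  shows "cong_join \<Sigma> B \<beta> \<gamma> \<in> congruences \<Sigma> B"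
proof -
  let ?T = "{\<theta> \<in> congruences \<Sigma> B. \<beta> \<union> \<gamma> \<subseteq> \<theta>}"
  have full: "univ B \<times> univ B \<in> ?T"
    using assms by (auto simp: congruences_def is_algebra_def equiv_def refl_on_def sym_def trans_def)
  have e: "equiv (univ B) \<theta>" if "\<theta> \<in> ?T" for \<theta>
    using that by (auto simp: congruences_def)
  have "equiv (univ B) (\<Inter>?T)"
  proof (rule equivI)
    show "\<Inter>?T \<subseteq> univ B \<times> univ B" using full by blast
    show "refl_on (univ B) (\<Inter>?T)"
      using e unfolding equiv_def refl_on_def by blast
    show "sym (\<Inter>?T)" using e unfolding equiv_def sym_def by blast
    show "trans (\<Inter>?T)" using e unfolding equiv_def trans_def by blast
  qed
  moreover have "(op B f xs, op B f ys) \<in> \<Inter>?T"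
    if f: "f \<in> syms \<Sigma>" "xs \<in> tuples (ar \<Sigma> f) (univ B)" "ys \<in> tuples (ar \<Sigma> f) (univ B)"
      and r: "list_all2 (\<lambda>x y. (x, y) \<in> \<Inter>?T) xs ys" for f xs ys
  proof
    fix \<theta> assume t: "\<theta> \<in> ?T"
    have "list_all2 (\<lambda>x y. (x, y) \<in> \<theta>) xs ys"
      using r t by (auto elim!: list_all2_mono)
    with f t show "(op B f xs, op B f ys) \<in> \<theta>" by (auto simp: congruences_def)
  qed
  ultimately show ?thesis unfolding cong_join_def congruences_def by blast
qed


section \<open>Birkhoff's theorem: the generated variety is HSP\<close>

definition power_alg :: "'j set \<Rightarrow> ('f, 'a) alg \<Rightarrow> ('f, 'j \<Rightarrow> 'a) alg" where
  "power_alg J Al =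
     \<lparr>univ = J \<rightarrow>\<^sub>E univ Al, op = (\<lambda>f xs. \<lambda>j\<in>J. op Al f (map (\<lambda>x. x j) xs))\<rparr>"

definition subuniverse :: "'f signature \<Rightarrow> ('f, 'b) alg \<Rightarrow> 'b set \<Rightarrow> bool" where
  "subuniverse \<Sigma> B C \<longleftrightarrow> C \<subseteq> univ B \<and> (\<forall>f \<in> syms \<Sigma>. \<forall>xs \<in> tuples (ar \<Sigma> f) C. op B f xs \<in> C)"

text \<open>\<open>h\<close> is a homomorphism from the subalgebra of \<open>P\<close> with universe \<open>C\<close> onto \<open>B\<close>.\<close>

definition epi_from :: "'f signature \<Rightarrow> 'c set \<Rightarrow> ('f, 'c) alg \<Rightarrow> ('c \<Rightarrow> 'b) \<Rightarrow> ('f, 'b) alg \<Rightarrow> bool" where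
  "epi_from \<Sigma> C P h B \<longleftrightarrow> h ` C = univ B \<and>
     (\<forall>f \<in> syms \<Sigma>. \<forall>xs \<in> tuples (ar \<Sigma> f) C. h (op P f xs) = op B f (map h xs))"

lemma trm_val_closed:
  assumes "is_algebra \<Sigma> B" "wf_trm \<Sigma> t" "\<And>x. x \<in> set2_trm t \<Longrightarrow> \<rho> x \<in> univ B"
  shows "trm_val B \<rho> t \<in> univ B"
  using assms(2,3)
proof (induction t)
  case (App f ts)
  then have "map (trm_val B \<rho>) ts \<in> tuples (ar \<Sigma> f) (univ B)" by (auto simp: tuples_def)
  with App assms(1) show ?case unfolding is_algebra_def by auto
qed auto

lemma trm_val_map: "trm_val B \<rho> (map_trm id g t) = trm_val B (\<lambda>x. \<rho> (g x)) t"
proof (induction t)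
  case (App f ts)
  have "map (trm_val B \<rho>) (map (map_trm id g) ts) = map (trm_val B (\<lambda>x. \<rho> (g x))) ts"
    unfolding list.map_comp by (rule map_cong) (use App.IH in \<open>simp_all only: comp_apply\<close>)
  then show ?case by (simp only: trm.map trm_val.simps id_def)
qed simp

lemma trm_val_cong: "(\<And>x. x \<in> set2_trm t \<Longrightarrow> \<rho> x = \<sigma> x) \<Longrightarrow> trm_val B \<rho> t = trm_val B \<sigma> t"
proof (induction t)
  case (App f ts)
  then have "map (trm_val B \<rho>) ts = map (trm_val B \<sigma>) ts" by auto
  then show ?case by (metis trm_val.simps(2))
qed auto

lemma wf_trm_map: "wf_trm \<Sigma> t \<Longrightarrow> wf_trm \<Sigma> (map_trm id g t)"
  by (induction t) auto

lemma finite_vars: "finite (set2_trm t)"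
  by (induction t) auto

lemma trm_val_power:
  "j \<in> J \<Longrightarrow> wf_trm \<Sigma> t \<Longrightarrow> trm_val (power_alg J Al) \<rho> t j = trm_val Al (\<lambda>x. \<rho> x j) t"
proof (induction t)
  case (App f ts)
  then have "map (\<lambda>x. trm_val (power_alg J Al) \<rho> x j) ts = map (trm_val Al (\<lambda>x. \<rho> x j)) ts"
    by auto
  moreover have "op (power_alg J Al) f xs j = op Al f (map (\<lambda>x. x j) xs)" for xs
    using App.prems by (simp add: power_alg_def)
  ultimately show ?case by (simp add: comp_def cong: map_cong)
qed auto

lemma is_algebra_power: "is_algebra \<Sigma> Al \<Longrightarrow> is_algebra \<Sigma> (power_alg J Al)"
  unfolding is_algebra_def
proof (intro ballI)
  fix f xs
  assume A: "\<forall>f\<in>syms \<Sigma>. \<forall>xs\<in>tuples (ar \<Sigma> f) (univ Al). op Al f xs \<in> univ Al"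
    and f: "f \<in> syms \<Sigma>" and xs: "xs \<in> tuples (ar \<Sigma> f) (univ (power_alg J Al))"
  have "map (\<lambda>x. x j) xs \<in> tuples (ar \<Sigma> f) (univ Al)" if "j \<in> J" for j
    using xs that by (auto simp: tuples_def power_alg_def)
  then show "op (power_alg J Al) f xs \<in> univ (power_alg J Al)"
    using A f by (simp add: power_alg_def)
qed

lemma trm_val_epi:
  assumes "subuniverse \<Sigma> P C" "epi_from \<Sigma> C P h B" "wf_trm \<Sigma> t" "range \<rho> \<subseteq> C"
  shows "trm_val P \<rho> t \<in> C \<and> h (trm_val P \<rho> t) = trm_val B (\<lambda>x. h (\<rho> x)) t"
  using assms(3)
proof (induction t)
  case (Var x)
  then show ?case using assms(4) by auto
next
  case (App f ts)
  then have *: "map (trm_val P \<rho>) ts \<in> tuples (ar \<Sigma> f) C" "f \<in> syms \<Sigma>" by (auto simp: tuples_def)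
  have "map (h \<circ> trm_val P \<rho>) ts = map (trm_val B (\<lambda>x. h (\<rho> x))) ts" using App by auto
  with * assms(1,2) show ?case unfolding subuniverse_def epi_from_def by (metis list.map_comp trm_val.simps(2))
qed

theorem HSP_imp_generated_variety:
  fixes B :: "('f, 'b) alg" and J :: "'j set"
  assumes B: "is_algebra \<Sigma> B" and C: "subuniverse \<Sigma> (power_alg J Al) C"
    and h: "epi_from \<Sigma> C (power_alg J Al) h B"
  shows "B \<in> generated_variety \<Sigma> Al"
  unfolding generated_variety_def
proof (intro CollectI conjI allI impI B)
  fix s t :: "('f, nat) trm"
  assume w: "wf_trm \<Sigma> s" "wf_trm \<Sigma> t" and st: "satisfies_id Al s t"
  let ?P = "power_alg J Al"
  show "satisfies_id B s t"
    unfolding satisfies_id_def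
  proof (intro allI impI)
    fix \<rho> :: "nat \<Rightarrow> 'b" assume \<rho>: "range \<rho> \<subseteq> univ B"
    define \<sigma> where "\<sigma> n = inv_into C h (\<rho> n)" for n
    have hC: "h ` C = univ B" using h by (simp add: epi_from_def)
    have \<sigma>: "range \<sigma> \<subseteq> C" "(\<lambda>n. h (\<sigma> n)) = \<rho>"
      using \<rho> hC by (auto simp: \<sigma>_def f_inv_into_f subset_eq intro!: inv_into_into)
    have CU: "C \<subseteq> J \<rightarrow>\<^sub>E univ Al" using C by (simp add: subuniverse_def power_alg_def)
    have es: "trm_val ?P \<sigma> s \<in> C" "trm_val ?P \<sigma> t \<in> C"
      using trm_val_epi[OF C h _ \<sigma>(1)] w by auto
    have "trm_val ?P \<sigma> s = trm_val ?P \<sigma> t"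
    proof (rule PiE_ext[where k = J and s = "\<lambda>_. univ Al"])
      fix j assume j: "j \<in> J"
      have "range (\<lambda>x. \<sigma> x j) \<subseteq> univ Al" using \<sigma>(1) CU j by blast
      then show "trm_val ?P \<sigma> s j = trm_val ?P \<sigma> t j"
        using st w j by (simp add: trm_val_power satisfies_id_def)
    qed (use es CU in auto)
    then show "trm_val B \<rho> s = trm_val B \<rho> t"
      using trm_val_epi[OF C h _ \<sigma>(1)] w \<sigma>(2) by metis
  qed
qed

theorem generated_variety_imp_HSP:
  fixes B :: "('f, 'b) alg" and Al :: "('f, 'a) alg"
  assumes A: "is_algebra \<Sigma> Al" and V: "B \<in> generated_variety \<Sigma> Al"
  shows "\<exists>(J :: ('b \<Rightarrow> 'a) set) C h.
    subuniverse \<Sigma> (power_alg J Al) C \<and> epi_from \<Sigma> C (power_alg J Al) h B"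
proof -
  define J :: "('b \<Rightarrow> 'a) set" where "J = (univ B \<rightarrow>\<^sub>E univ Al)"
  let ?P = "power_alg J Al"
  define T where "T = {t :: ('f, 'b) trm. wf_trm \<Sigma> t \<and> set2_trm t \<subseteq> univ B}"
  define \<pi> where "\<pi> b = (\<lambda>j\<in>J. j b)" for b
  let ?e = "trm_val ?P \<pi>"
  define C where "C = ?e ` T"
  define h where "h c = trm_val B (\<lambda>b. b) (SOME t. t \<in> T \<and> ?e t = c)" for c
  have B: "is_algebra \<Sigma> B" using V by (simp add: generated_variety_def)
  have key: "trm_val B (\<lambda>b. b) s = trm_val B (\<lambda>b. b) t"
    if s: "s \<in> T" and t: "t \<in> T" and eq: "?e s = ?e t" for s t
  proof -
    let ?X = "set2_trm s \<union> set2_trm t"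
    obtain g :: "'b \<Rightarrow> nat" where g: "inj_on g ?X"
      using finite_imp_inj_to_nat_seg[of ?X] finite_vars by blast
    have w: "wf_trm \<Sigma> s" "wf_trm \<Sigma> t" "?X \<subseteq> univ B" using s t by (auto simp: T_def)
    have "satisfies_id Al (map_trm id g s) (map_trm id g t)"
      unfolding satisfies_id_def trm_val_map
    proof (intro allI impI)
      fix \<rho> :: "nat \<Rightarrow> 'a" assume \<rho>: "range \<rho> \<subseteq> univ Al"
      define j where "j = (\<lambda>b\<in>univ B. \<rho> (g b))"
      have j: "j \<in> J" using \<rho> by (auto simp: j_def J_def)
      have "trm_val Al (\<lambda>x. \<rho> (g x)) u = ?e u j" if "wf_trm \<Sigma> u" "set2_trm u \<subseteq> univ B" for u
        unfolding trm_val_power[OF j that(1)]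
        by (rule trm_val_cong) (use that(2) j in \<open>auto simp: \<pi>_def j_def\<close>)
      with w eq show "trm_val Al (\<lambda>x. \<rho> (g x)) s = trm_val Al (\<lambda>x. \<rho> (g x)) t" by auto
    qed
    then have id: "satisfies_id B (map_trm id g s) (map_trm id g t)"
      using V w by (auto simp: generated_variety_def wf_trm_map)
    have sB: "trm_val B (\<lambda>b. b) s \<in> univ B"
      using trm_val_closed[OF B w(1), of "\<lambda>b. b"] w(3) by auto
    define \<rho> where "\<rho> n = (if n \<in> g ` ?X then inv_into ?X g n else trm_val B (\<lambda>b. b) s)" for n
    have "range \<rho> \<subseteq> univ B"
    proof (rule image_subsetI)
      fix n
      show "\<rho> n \<in> univ B"
      proof (cases "n \<in> g ` ?X")
        case True
        then have "inv_into ?X g n \<in> ?X" by (rule inv_into_into)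
        then have "inv_into ?X g n \<in> univ B" using w(3) by (rule subsetD[rotated])
        then show ?thesis unfolding \<rho>_def using True by (simp only: if_True)
      next
        case False
        then show ?thesis unfolding \<rho>_def using sB by (simp only: if_False)
      qed
    qed
    with id have "trm_val B (\<lambda>x. \<rho> (g x)) s = trm_val B (\<lambda>x. \<rho> (g x)) t"
      by (simp add: satisfies_id_def trm_val_map)
    moreover have "\<rho> (g x) = x" if "x \<in> ?X" for x
      using that g by (simp add: \<rho>_def inv_into_f_f del: Un_iff)
    then have "trm_val B (\<lambda>x. \<rho> (g x)) u = trm_val B (\<lambda>b. b) u" if "u = s \<or> u = t" for u
      using that by (intro trm_val_cong) auto
    ultimately show ?thesis by simp
  qed
  have h: "h (?e t) = trm_val B (\<lambda>b. b) t" if t: "t \<in> T" for t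
  proof -
    have "(SOME u. u \<in> T \<and> ?e u = ?e t) \<in> T \<and> ?e (SOME u. u \<in> T \<and> ?e u = ?e t) = ?e t"
      by (rule someI[of _ t]) (use t in simp)
    then show ?thesis unfolding h_def using key t by blast
  qed
  have step: "op ?P f xs \<in> C \<and> h (op ?P f xs) = op B f (map h xs)"
    if f: "f \<in> syms \<Sigma>" and xs: "xs \<in> tuples (ar \<Sigma> f) C" for f xs
  proof -
    have "xs \<in> lists C" using xs by (simp add: tuples_def in_lists_conv_set subset_iff)
    then obtain ts where "ts \<in> lists T" and "xs = map ?e ts"
      unfolding C_def lists_image by (rule imageE)
    then have ts: "set ts \<subseteq> T" "length ts = length xs" "xs = map ?e ts"
      by (simp_all only: lists_eq_set mem_Collect_eq length_map)
    have T: "App f ts \<in> T" using ts f xs by (auto simp: T_def tuples_def)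
    have e: "op ?P f xs = ?e (App f ts)" using ts by simp
    have m: "map h xs = map (trm_val B (\<lambda>b. b)) ts" using ts h by auto
    have "?e (App f ts) \<in> C" unfolding C_def using T by (rule imageI)
    then show ?thesis unfolding e m using h[OF T] by simp
  qed
  have \<pi>: "\<pi> b \<in> univ ?P" if "b \<in> univ B" for b
    using that by (auto simp: \<pi>_def power_alg_def J_def)
  have "?e t \<in> univ ?P" if "t \<in> T" for t
    by (rule trm_val_closed[OF is_algebra_power[OF A]]) (use that \<pi> in \<open>auto simp: T_def\<close>)
  then have "C \<subseteq> univ ?P" unfolding C_def by (rule image_subsetI)
  then have "subuniverse \<Sigma> ?P C" using step by (simp add: subuniverse_def)
  moreover have "h ` C = univ B"
  proof
    show "h ` C \<subseteq> univ B"
    proof -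
      have "trm_val B (\<lambda>b. b) t \<in> univ B" if "t \<in> T" for t
        by (rule trm_val_closed[OF B]) (use that in \<open>auto simp: T_def\<close>)
      then show ?thesis unfolding C_def using h by auto
    qed
    show "univ B \<subseteq> h ` C"
    proof
      fix b assume "b \<in> univ B"
      then have "Var b \<in> T" by (simp add: T_def)
      then show "b \<in> h ` C" using h[of "Var b"] unfolding C_def by (metis image_eqI trm_val.simps(1))
    qed
  qed
  then have "epi_from \<Sigma> C ?P h B" using step by (simp add: epi_from_def)
  ultimately show ?thesis by blast
qed

end

theory Submission
  imports Defs
begin

text \<open>
  On a two-element set \<open>{a, b}\<close> a Taylor operation yields a ternary polymorphism that is
  semilattice-like, majority or minority there. The minority case never stands alone: from a
  minority \<open>h\<close> on \<open>{a, b}\<close> one builds ternary polymorphisms \<open>t1, t2, t3\<close> that are the three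
  projections on \<open>{a, b}\<close> but never take three distinct values at the same argument. Taking the
  majority of their values preserves every binary relation, because two majorities of three always
  share a coordinate, and it is the majority operation on \<open>{a, b}\<close>. Gluing over all pairs gives a
  weak near-unanimity polymorphism \<open>g\<close> for which \<open>s(x, y) = g(x, x, y)\<close> satisfies
  \<open>s(x, s(x, y)) = s(s(x, y), x)\<close>. Willard's argument, which walks along a chain of \<open>\<beta>\<close>- and
  \<open>\<gamma>\<close>-steps from \<open>a\<close> to \<open>b\<close> in the middle argument of \<open>g(a, _, b)\<close>, then shows \<open>SD(\<and>)\<close>.
\<close>

section \<open>Conservative ternary polymorphisms and their minors\<close>

text \<open>
  Unary relations enter only through \<open>p x y z \<in> {x, y, z}\<close>, which 3-conservativity forces.
\<close>

definition ternary_pol :: "('i, 'a) rel_struct \<Rightarrow> ('a \<Rightarrow> 'a \<Rightarrow> 'a \<Rightarrow> 'a) \<Rightarrow> bool" where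
  "ternary_pol S p \<longleftrightarrow>
     (\<forall>x \<in> dom S. \<forall>y \<in> dom S. \<forall>z \<in> dom S. p x y z \<in> {x, y, z}) \<and>
     (\<forall>i \<in> idx S. rel_ar S i = 2 \<longrightarrow>
        (\<forall>x x' y y' z z'. [x, x'] \<in> rel S i \<longrightarrow> [y, y'] \<in> rel S i \<longrightarrow> [z, z'] \<in> rel S i \<longrightarrow>
           [p x y z, p x' y' z'] \<in> rel S i))"

lemma ternary_pol_in:
  "ternary_pol S p \<Longrightarrow> x \<in> dom S \<Longrightarrow> y \<in> dom S \<Longrightarrow> z \<in> dom S \<Longrightarrow> p x y z \<in> {x, y, z}"
  by (simp add: ternary_pol_def)

lemma ternary_pol_rel:
  "ternary_pol S p \<Longrightarrow> i \<in> idx S \<Longrightarrow> rel_ar S i = 2 \<Longrightarrow>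
    [x, x'] \<in> rel S i \<Longrightarrow> [y, y'] \<in> rel S i \<Longrightarrow> [z, z'] \<in> rel S i \<Longrightarrow>
    [p x y z, p x' y' z'] \<in> rel S i"
  by (simp add: ternary_pol_def)

lemma ternary_pol_dom:
  "ternary_pol S p \<Longrightarrow> x \<in> dom S \<Longrightarrow> y \<in> dom S \<Longrightarrow> z \<in> dom S \<Longrightarrow> p x y z \<in> dom S"
  using ternary_pol_in by fastforce

lemma ternary_pol_proj [simp]:
  "ternary_pol S (\<lambda>x y z. x)" "ternary_pol S (\<lambda>x y z. y)" "ternary_pol S (\<lambda>x y z. z)"
  by (auto simp: ternary_pol_def)

lemma ternary_pol_comp:
  assumes "ternary_pol S p" "ternary_pol S q" "ternary_pol S r" "ternary_pol S s"
  shows "ternary_pol S (\<lambda>x y z. p (q x y z) (r x y z) (s x y z))"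
proof -
  have "p (q x y z) (r x y z) (s x y z) \<in> {x, y, z}"
    if d: "x \<in> dom S" "y \<in> dom S" "z \<in> dom S" for x y z
    using ternary_pol_in[OF assms(1), of "q x y z" "r x y z" "s x y z"]
      ternary_pol_in[OF assms(2) d] ternary_pol_in[OF assms(3) d] ternary_pol_in[OF assms(4) d] d
    by auto
  moreover have "[p (q x y z) (r x y z) (s x y z), p (q x' y' z') (r x' y' z') (s x' y' z')] \<in> rel S i"
    if "i \<in> idx S" "rel_ar S i = 2" "[x, x'] \<in> rel S i" "[y, y'] \<in> rel S i" "[z, z'] \<in> rel S i"
    for i x x' y y' z z'
    by (intro ternary_pol_rel[OF assms(1) that(1,2)] assms(2-4)[THEN ternary_pol_rel] that)
  ultimately show ?thesis unfolding ternary_pol_def by blast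
qed

text \<open>Identifying variables along three blocks of coordinates turns \<open>f\<close> into a
  ternary operation. The basic unary relation with elements \<open>x, y, z\<close>, present even if
  some of them coincide, forces conservativity.\<close>

lemma ternary_pol_minor:
  assumes c: "three_conservative S" and t: "(n, f) \<in> Pol S"
  shows "ternary_pol S (\<lambda>x y z. f (map (\<lambda>i. if i \<in> U then x else if i \<in> V then y else z) [0..<n]))"
proof -
  define w where "w x y z i = (if i \<in> U then x else if i \<in> V then y else z)" for x y z :: "'b" and i
  define ws where "ws x y z i = (if i \<in> U then x else if i \<in> V then y else z)" for x y z :: "'b list" and i
  have pres: "map (\<lambda>j. f (map (\<lambda>t. t ! j) (map (ws x y z) [0..<n]))) [0..<rel_ar S i] \<in> rel S i"
    if "i \<in> idx S" "x \<in> rel S i" "y \<in> rel S i" "z \<in> rel S i" for i x y z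
  proof -
    have "map (ws x y z) [0..<n] \<in> tuples n (rel S i)"
      using that by (auto simp: tuples_def ws_def)
    moreover have "preserves (n, f) (rel_ar S i) (rel S i)"
      using t that(1) by (simp add: Pol_def)
    ultimately show ?thesis by (simp only: preserves_def fst_conv snd_conv)
  qed
  have nth: "map (\<lambda>t. t ! j) (map (ws x y z) [0..<n]) = map (w (x ! j) (y ! j) (z ! j)) [0..<n]"
    for x y z j
    by (auto simp: w_def ws_def)
  have "f (map (w x y z) [0..<n]) \<in> {x, y, z}"
    if d: "x \<in> dom S" "y \<in> dom S" "z \<in> dom S" for x y z
  proof -
    have "card {x, y, z} \<in> {1, 2, 3}"
      by (auto simp: card_insert_if)
    then obtain i where i: "i \<in> idx S" "rel_ar S i = 1" "rel S i = (\<lambda>x. [x]) ` {x, y, z}"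
      using c d unfolding three_conservative_def by (metis empty_subsetI insert_subset)
    show ?thesis
      using pres[OF i(1), of "[x]" "[y]" "[z]"] i(2,3) unfolding nth by auto
  qed
  moreover have "[f (map (w x y z) [0..<n]), f (map (w x' y' z') [0..<n])] \<in> rel S i"
    if "i \<in> idx S" "rel_ar S i = 2" "[x, x'] \<in> rel S i" "[y, y'] \<in> rel S i" "[z, z'] \<in> rel S i"
    for i x x' y y' z z'
    using pres[OF that(1,3-5)] that(2) unfolding nth by (simp add: numeral_2_eq_2)
  ultimately show ?thesis unfolding ternary_pol_def w_def by blast
qed

lemma ternary_pol_imp_Pol:
  assumes S: "is_rel_struct S" "\<forall>i \<in> idx S. rel_ar S i \<in> {1, 2}" and p: "ternary_pol S p"
  shows "(3, \<lambda>xs \<in> tuples 3 (dom S). p (xs ! 0) (xs ! 1) (xs ! 2)) \<in> Pol S"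
proof -
  let ?g = "(3::nat, \<lambda>xs \<in> tuples 3 (dom S). p (xs ! 0) (xs ! 1) (xs ! 2))"
  have tup: "\<exists>x y z. ts = [x, y, z] \<and> x \<in> X \<and> y \<in> X \<and> z \<in> X" if "ts \<in> tuples 3 X" for ts and X :: "'c set"
    using that by (auto simp: tuples_def numeral_3_eq_3 length_Suc_conv)
  have "p (xs ! 0) (xs ! 1) (xs ! 2) \<in> dom S" if "xs \<in> tuples 3 (dom S)" for xs
    using tup[OF that] ternary_pol_dom[OF p] by auto
  then have "?g \<in> operations (dom S)"
    by (auto simp: operations_def)
  moreover have "preserves ?g (rel_ar S i) (rel S i)" if i: "i \<in> idx S" for i
    unfolding preserves_def
  proof
    fix ts assume "ts \<in> tuples (fst ?g) (rel S i)"
    then obtain x y z where t: "ts = [x, y, z]" "x \<in> rel S i" "y \<in> rel S i" "z \<in> rel S i"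
      using tup[of ts "rel S i"] by auto
    have rel: "length u = rel_ar S i \<and> set u \<subseteq> dom S" if "u \<in> rel S i" for u
      using S(1) i that by (auto simp: is_rel_struct_def tuples_def)
    consider "rel_ar S i = 1" | "rel_ar S i = 2" using S(2) i by auto
    then show "map (\<lambda>j. snd ?g (map (\<lambda>t. t ! j) ts)) [0..<rel_ar S i] \<in> rel S i"
    proof cases
      case 1
      then obtain x' y' z' where e: "x = [x']" "y = [y']" "z = [z']" "{x', y', z'} \<subseteq> dom S"
        using rel[OF t(2)] rel[OF t(3)] rel[OF t(4)] by (auto simp: length_Suc_conv)
      then show ?thesis using 1 t ternary_pol_in[OF p, of x' y' z'] by (auto simp: tuples_def)
    next
      case 2
      then obtain x' y' z' x'' y'' z''
        where e: "x = [x', x'']" "y = [y', y'']" "z = [z', z'']" "{x', y', z', x'', y'', z''} \<subseteq> dom S"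
        using rel[OF t(2)] rel[OF t(3)] rel[OF t(4)] by (auto simp: length_Suc_conv numeral_2_eq_2)
      then show ?thesis using 2 t p i by (auto simp: tuples_def ternary_pol_def upt_rec)
    qed
  qed
  ultimately show ?thesis by (simp add: Pol_def)
qed

section \<open>Weak near-unanimity on a two-element set\<close>

definition wnu_on :: "('a \<Rightarrow> 'a \<Rightarrow> 'a \<Rightarrow> 'a) \<Rightarrow> 'a \<Rightarrow> 'a \<Rightarrow> bool" where
  "wnu_on p a b \<longleftrightarrow>
     p a b a = p a a b \<and> p b a a = p a a b \<and> p b a b = p b b a \<and> p a b b = p b b a"

lemma ternary_pol_pair:
  assumes "ternary_pol S p" "a \<in> dom S" "b \<in> dom S"
  shows "p a a b = a \<or> p a a b = b" "p a b a = a \<or> p a b a = b" "p b a a = a \<or> p b a a = b"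
    "p b b a = a \<or> p b b a = b" "p b a b = a \<or> p b a b = b" "p a b b = a \<or> p a b b = b"
    "p a a a = a" "p b b b = b"
  using assms ternary_pol_in[OF assms(1)] by blast+

text \<open>If \<open>wnu_on\<close> always fails, exchanging \<open>a\<close> and \<open>b\<close>
  changes the value of \<open>p\<close> on mixed triples, so the three values in the conclusion
  determine \<open>p\<close> on the pair. With no \<open>b\<close> among them \<open>p\<close> is
  majority, with three it is minority, both excluded; with two it is a Pixley operation up to a
  permutation of variables, from which majority is composed; with one it is a projection.\<close>

lemma projection_on_pair:
  assumes p: "ternary_pol S p" and ab: "a \<in> dom S" "b \<in> dom S" "a \<noteq> b"
    and no: "\<And>q. ternary_pol S q \<Longrightarrow> \<not> wnu_on q a b"
  shows "p b a a = b \<and> p a b a = a \<and> p a a b = a \<or>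
    p b a a = a \<and> p a b a = b \<and> p a a b = a \<or>
    p b a a = a \<and> p a b a = a \<and> p a a b = b"
proof -
  note v = ternary_pol_pair[OF p ab(1,2)]
  have semi: "q a a b \<noteq> q b b a" if q: "ternary_pol S q" for q
  proof
    assume e: "q a a b = q b b a"
    \<comment> \<open>With the semilattice operation \<open>s(x, y) = q x x y\<close> on the pair,
      this is \<open>s(s(x, y), z)\<close>.\<close>
    have "ternary_pol S (\<lambda>x y z. q (q x x y) (q x x y) z)"
      by (intro ternary_pol_comp[OF q] ternary_pol_proj)
    moreover have "wnu_on (\<lambda>x y z. q (q x x y) (q x x y) z) a b"
      using ternary_pol_pair(1)[OF q ab(1,2)]
      by (rule disjE) (use e ternary_pol_pair(7,8)[OF q ab(1,2)] in \<open>simp_all add: wnu_on_def\<close>)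
    ultimately show False using no by blast
  qed
  have "p a a b \<noteq> p b b a" "p a b a \<noteq> p b a b" "p b a a \<noteq> p a b b"
    using semi[OF p] semi[of "\<lambda>x y z. p x z y"] semi[of "\<lambda>x y z. p z x y"]
    by (simp_all add: ternary_pol_comp[OF p])
  moreover have "\<not> wnu_on p a b" using no p by blast
  moreover have pix: "\<not> (q a a b = b \<and> q a b a = a \<and> q b a a = b \<and> q b b a = a \<and> q b a b = b \<and> q a b b = a)"
    if q: "ternary_pol S q" for q
  proof
    assume e: "q a a b = b \<and> q a b a = a \<and> q b a a = b \<and> q b b a = a \<and> q b a b = b \<and> q a b b = a"
    have "ternary_pol S (\<lambda>x y z. q x (q x y z) z)"
      by (intro ternary_pol_comp[OF q] ternary_pol_proj)
    moreover have "wnu_on (\<lambda>x y z. q x (q x y z) z) a b"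
      using e ternary_pol_pair(7,8)[OF q ab(1,2)] by (simp add: wnu_on_def)
    ultimately show False using no by blast
  qed
  moreover note pix[OF p]
  moreover have "ternary_pol S (\<lambda>x y z. p x z y)" "ternary_pol S (\<lambda>x y z. p y x z)"
    by (simp_all add: ternary_pol_comp[OF p])
  note this[THEN pix]
  ultimately show ?thesis
    using v(1-6) ab(3) unfolding wnu_on_def by (elim disjE) simp_all
qed

text \<open>Otherwise every ternary minor is a projection on the pair. The sets of coordinates whose
  indicator tuple \<open>f\<close> sends to \<open>b\<close> then form an ultrafilter on a finite
  set, hence a principal one, so \<open>f\<close> is a projection on the pair, against a Taylor
  identity.\<close>

lemma taylor_imp_wnu_on_pair:
  assumes c: "three_conservative S" and t: "t \<in> Pol S" "taylor_on (dom S) t"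
    and ab: "a \<in> dom S" "b \<in> dom S" "a \<noteq> b"
  shows "\<exists>p. ternary_pol S p \<and> wnu_on p a b"
proof (rule ccontr)
  assume "\<not> ?thesis"
  then have no: "\<And>q. ternary_pol S q \<Longrightarrow> \<not> wnu_on q a b" by blast
  obtain n f where nf: "t = (n, f)" by force
  define \<chi> where "\<chi> U = map (\<lambda>i. if i \<in> U then b else a) [0..<n]" for U :: "nat set"
  define F where "F = {U. U \<subseteq> {..<n} \<and> f (\<chi> U) = b}"
  \<comment> \<open>Exactly one block of a partition into three, empty blocks allowed, lies in
    \<open>F\<close>, as the minor for these blocks is a projection.\<close>
  have one: "(U \<in> F \<and> V \<notin> F \<and> W \<notin> F) \<or> (U \<notin> F \<and> V \<in> F \<and> W \<notin> F) \<or> (U \<notin> F \<and> V \<notin> F \<and> W \<in> F)"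
    if "U \<inter> V = {}" "W = {..<n} - U - V" "U \<subseteq> {..<n}" "V \<subseteq> {..<n}" for U V W
  proof -
    let ?p = "\<lambda>x y z. f (map (\<lambda>i. if i \<in> U then x else if i \<in> V then y else z) [0..<n])"
    have "?p b a a = f (\<chi> U)" "?p a b a = f (\<chi> V)" "?p a a b = f (\<chi> W)"
      using that unfolding \<chi>_def by (auto intro!: arg_cong[where f = f])
    then show ?thesis
      using projection_on_pair[OF ternary_pol_minor[OF c t(1)[unfolded nf], of U V] ab no] that ab(3)
      unfolding F_def by auto
  qed
  have emp: "{} \<notin> F" "{..<n} \<in> F"
    using one[of "{}" "{}" "{..<n}"] by auto
  define U where "U = arg_min card (\<lambda>U. U \<in> F)"
  have U: "U \<in> F" "\<And>V. V \<in> F \<Longrightarrow> card U \<le> card V"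
    using arg_min_nat_lemma[of "\<lambda>U. U \<in> F", OF emp(2), of card] unfolding U_def by auto
  have finU: "finite U" "U \<subseteq> {..<n}" using U(1) by (auto simp: F_def intro: finite_subset)
  obtain k where k: "k \<in> U" using U(1) emp(1) by (cases "U = {}") auto
  have "{k} \<in> F"
  proof (rule ccontr)
    assume nk: "{k} \<notin> F"
    have "card (U - {k}) < card U" using k finU by (intro psubset_card_mono) auto
    then have "U - {k} \<notin> F" using U(2) by fastforce
    then have "{..<n} - {k} - (U - {k}) \<in> F"
      using one[of "{k}" "U - {k}"] nk k finU by auto
    \<comment> \<open>By minimality of \<open>U\<close> only the third block is left, and it is the
      complement of \<open>U\<close>; but a set and its complement cannot both lie in
      \<open>F\<close>.\<close>
    moreover have "{..<n} - {k} - (U - {k}) = {..<n} - U - {}" using k by auto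
    ultimately show False
      using one[of U "{}"] U(1) finU by auto
  qed
  then have kn: "k < n" by (simp add: F_def)
  have proj: "V \<in> F \<longleftrightarrow> k \<in> V" if V: "V \<subseteq> {..<n}" for V
  proof (cases "k \<in> V")
    case True
    have "{k} \<inter> ({..<n} - V) = {}" using True by auto
    then have "{..<n} - V \<notin> F" using one[of "{k}" "{..<n} - V"] \<open>{k} \<in> F\<close> kn by auto
    then show ?thesis using one[of V "{}"] True V emp by auto
  next
    case False
    then show ?thesis using one[of "{k}" V] V \<open>{k} \<in> F\<close> kn by auto
  qed
  obtain u v :: "nat list" where uv: "length u = n" "length v = n" "u ! k \<noteq> v ! k"
    and id: "\<And>\<rho>. range \<rho> \<subseteq> dom S \<Longrightarrow> f (map \<rho> u) = f (map \<rho> v)"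
    using t(2) kn unfolding taylor_on_def nf by auto
  \<comment> \<open>The sides of the \<open>k\<close>-th identity carry different variables at
    position \<open>k\<close>; sending that of \<open>u\<close> to \<open>b\<close> and all others
    to \<open>a\<close> separates them.\<close>
  define \<rho> where "\<rho> i = (if i = u ! k then b else a)" for i
  have *: "map \<rho> w = \<chi> {i. i < n \<and> w ! i = u ! k}" if "length w = n" for w
    using that by (auto simp: \<rho>_def \<chi>_def intro!: nth_equalityI)
  have "f (map \<rho> w) = b \<longleftrightarrow> w ! k = u ! k" if "length w = n" for w
    using proj[of "{i. i < n \<and> w ! i = u ! k}"] kn unfolding F_def *[OF that] by auto
  from this[OF uv(1)] this[OF uv(2)] have "f (map \<rho> u) \<noteq> f (map \<rho> v)" using uv(3) by auto
  moreover have "range \<rho> \<subseteq> dom S" using ab by (auto simp: \<rho>_def)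
  ultimately show False using id by blast
qed

section \<open>From minority to majority\<close>

text \<open>The value on three distinct arguments is junk.\<close>

definition majority_of :: "'a \<Rightarrow> 'a \<Rightarrow> 'a \<Rightarrow> 'a" where
  "majority_of x y z = (if y = z then y else x)"

lemma ternary_pol_majority_of:
  assumes S: "is_rel_struct S" and t: "ternary_pol S t1" "ternary_pol S t2" "ternary_pol S t3"
    and eq: "\<And>x y z. x \<in> dom S \<Longrightarrow> y \<in> dom S \<Longrightarrow> z \<in> dom S \<Longrightarrow>
      t1 x y z = t2 x y z \<or> t1 x y z = t3 x y z \<or> t2 x y z = t3 x y z"
  shows "ternary_pol S (\<lambda>x y z. majority_of (t1 x y z) (t2 x y z) (t3 x y z))"
proof -
  let ?m = "\<lambda>x y z. majority_of (t1 x y z) (t2 x y z) (t3 x y z)"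
  have "?m x y z \<in> {x, y, z}" if "x \<in> dom S" "y \<in> dom S" "z \<in> dom S" for x y z
    using t[THEN ternary_pol_in, OF that] by (simp add: majority_of_def)
  moreover have "[?m x y z, ?m x' y' z'] \<in> rel S i"
    if i: "i \<in> idx S" "rel_ar S i = 2" and r: "[x, x'] \<in> rel S i" "[y, y'] \<in> rel S i" "[z, z'] \<in> rel S i"
    for i x x' y y' z z'
  proof -
    have d: "{x, x', y, y', z, z'} \<subseteq> dom S"
      using S i(1) r by (force simp: is_rel_struct_def tuples_def)
    have "[q x y z, q x' y' z'] \<in> rel S i" if "ternary_pol S q" for q
      using that i r by (auto simp: ternary_pol_def)
    from this[OF t(1)] this[OF t(2)] this[OF t(3)] show ?thesis
      using eq[of x y z] eq[of x' y' z'] d by (auto simp: majority_of_def)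
  qed
  ultimately show ?thesis unfolding ternary_pol_def by blast
qed

text \<open>Among the triples of polymorphisms that are the three projections on the pair, one with
  the fewest arguments taken to three distinct values has no such argument, so the majority of its
  components is a polymorphism.\<close>

lemma minority_imp_majority:
  assumes S: "is_rel_struct S" "finite (dom S)"
    and ab: "a \<in> dom S" "b \<in> dom S" "a \<noteq> b"
    and h: "ternary_pol S h" "wnu_on h a b" "h a a b = b" "h b b a = a"
  obtains p where "ternary_pol S p" "wnu_on p a b" "p a a b = a" "p b b a = b"
proof -
  have hv: "h a a b = b" "h a b a = b" "h b a a = b" "h b b a = a" "h b a b = a" "h a b b = a"
    "h a a a = a" "h b b b = b"
    using h(2-4) ternary_pol_pair(7,8)[OF h(1) ab(1,2)] by (simp_all add: wnu_on_def)
  define T where "T = {(t1, t2, t3). ternary_pol S t1 \<and> ternary_pol S t2 \<and> ternary_pol S t3 \<and>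
     (\<forall>x \<in> {a, b}. \<forall>y \<in> {a, b}. \<forall>z \<in> {a, b}. t1 x y z = x \<and> t2 x y z = y \<and> t3 x y z = z)}"
  define inj3 where "inj3 x y z \<longleftrightarrow> x \<noteq> y \<and> x \<noteq> z \<and> y \<noteq> z" for x y z :: 'b
  define N where "N = (\<lambda>(t1, t2, t3). {(x, y, z). x \<in> dom S \<and> y \<in> dom S \<and> z \<in> dom S \<and>
     inj3 (t1 x y z) (t2 x y z) (t3 x y z)})"
  have collapse: "\<exists>t1 t2 t3. (t1, t2, t3) \<in> T \<and> \<not> inj3 (t1 x y z) (t2 x y z) (t3 x y z)"
    if d: "x \<in> dom S" "y \<in> dom S" "z \<in> dom S" for x y z
  proof -
    \<comment> \<open>On \<open>{a, b}\<close> both are the first projection, as \<open>h\<close> is \<open>x + y + z\<close> there. If neither \<open>?s x y z\<close>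
      nor \<open>?s y x z\<close> repeats one of the other two arguments, then \<open>h x y z = x\<close> and \<open>h y x z = y\<close>, so
      \<open>?c x y z = y\<close>.\<close>
    let ?s = "\<lambda>x y z. h (h x y z) y z" and ?c = "\<lambda>x y z. h y (h x y z) z"
    have T: "(?s, \<lambda>x y z. y, \<lambda>x y z. z) \<in> T" "(\<lambda>x y z. x, \<lambda>x y z. ?s y x z, \<lambda>x y z. z) \<in> T"
      "(?c, \<lambda>x y z. y, \<lambda>x y z. z) \<in> T"
      unfolding T_def by (auto simp: hv intro!: ternary_pol_comp[OF h(1)] h(1))
    have "\<not> inj3 (?s x y z) y z \<or> \<not> inj3 x (?s y x z) z \<or> \<not> inj3 (?c x y z) y z"
    proof -
      have "h x y z \<in> {x, y, z}" "h y x z \<in> {x, y, z}" "h y y z \<in> {y, z}" "h z y z \<in> {y, z}"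
        "h x x z \<in> {x, z}" "h z x z \<in> {x, z}"
        using ternary_pol_in[OF h(1)] d by blast+
      then show ?thesis unfolding inj3_def by auto
    qed
    then show ?thesis
      by (elim disjE) (intro exI conjI, rule T(1), simp, intro exI conjI, rule T(2), simp,
        intro exI conjI, rule T(3), simp)
  qed
  have "(\<lambda>x y z. x, \<lambda>x y z. y, \<lambda>x y z. z) \<in> T" by (simp add: T_def)
  then obtain t where t: "t \<in> T" "\<And>t'. t' \<in> T \<Longrightarrow> card (N t) \<le> card (N t')"
    using ex_has_least_nat[of "\<lambda>t. t \<in> T" _ "\<lambda>t. card (N t)"] by blast
  obtain t1 t2 t3 where t123: "t = (t1, t2, t3)" by (cases t)
  have tp: "ternary_pol S t1" "ternary_pol S t2" "ternary_pol S t3"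
    using t(1) by (auto simp: T_def t123)
  have finN: "finite (N t)" for t
  proof -
    have "N t \<subseteq> dom S \<times> dom S \<times> dom S" by (auto simp: N_def split: prod.splits)
    then show ?thesis using S(2) finite_subset by blast
  qed
  have ninj: "\<not> inj3 (t1 x y z) (t2 x y z) (t3 x y z)"
    if d: "x \<in> dom S" "y \<in> dom S" "z \<in> dom S" for x y z
  proof
    assume i: "inj3 (t1 x y z) (t2 x y z) (t3 x y z)"
    obtain r1 r2 r3 where r: "(r1, r2, r3) \<in> T"
      "\<not> inj3 (r1 (t1 x y z) (t2 x y z) (t3 x y z)) (r2 (t1 x y z) (t2 x y z) (t3 x y z))
         (r3 (t1 x y z) (t2 x y z) (t3 x y z))"
      using collapse[OF tp[THEN ternary_pol_dom, OF d]] by blast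
    have rp: "ternary_pol S r1" "ternary_pol S r2" "ternary_pol S r3" using r(1) by (auto simp: T_def)
    \<comment> \<open>Applying \<open>r1\<close>, \<open>r2\<close>, \<open>r3\<close> after the
      triple \<open>t\<close> repairs the bad argument and, since each picks one of its inputs,
      creates no new one.\<close>
    define c where "c r = (\<lambda>x y z. r (t1 x y z) (t2 x y z) (t3 x y z))" for r :: "'b \<Rightarrow> 'b \<Rightarrow> 'b \<Rightarrow> 'b"
    have cT: "(c r1, c r2, c r3) \<in> T"
      using t(1) r(1) rp[THEN ternary_pol_comp, OF tp] unfolding T_def t123 c_def by auto
    have "N (c r1, c r2, c r3) \<subseteq> N t"
    proof -
      have False if d: "x \<in> dom S" "y \<in> dom S" "z \<in> dom S"
        and "inj3 (c r1 x y z) (c r2 x y z) (c r3 x y z)" "\<not> inj3 (t1 x y z) (t2 x y z) (t3 x y z)" for x y z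
      proof -
        let ?x = "t1 x y z" and ?y = "t2 x y z" and ?z = "t3 x y z"
        show False
          using that(4,5) rp[THEN ternary_pol_in, OF tp[THEN ternary_pol_dom, OF d]] unfolding c_def inj3_def by auto
      qed
      then show ?thesis by (auto simp: N_def t123)
    qed
    moreover have "(x, y, z) \<in> N t - N (c r1, c r2, c r3)"
      using d i r(2) by (auto simp: N_def t123 c_def)
    ultimately have "card (N (c r1, c r2, c r3)) < card (N t)"
      using finN by (intro psubset_card_mono) auto
    then show False using t(2)[OF cT] by simp
  qed
  have "ternary_pol S (\<lambda>x y z. majority_of (t1 x y z) (t2 x y z) (t3 x y z))"
    using ninj by (intro ternary_pol_majority_of S tp) (auto simp: inj3_def)
  then show ?thesis
    by (rule that) (use t(1) ab(3) in \<open>auto simp: T_def t123 majority_of_def wnu_on_def\<close>)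
qed

section \<open>Gluing over all pairs\<close>

text \<open>With idempotence, \<open>wnu_on\<close> leaves semilattice, majority and minority
  operations on the pair; the last clause excludes minority.\<close>

definition semilattice_or_majority_on :: "('a \<Rightarrow> 'a \<Rightarrow> 'a \<Rightarrow> 'a) \<Rightarrow> 'a \<Rightarrow> 'a \<Rightarrow> bool" where
  "semilattice_or_majority_on p a b \<longleftrightarrow> wnu_on p a b \<and> \<not> (p a a b = b \<and> p b b a = a)"

lemma exists_semilattice_or_majority_on_pair:
  assumes "is_rel_struct S" "finite (dom S)" "three_conservative S" "admits_taylor S"
    and ab: "a \<in> dom S" "b \<in> dom S" "a \<noteq> b"
  shows "\<exists>p. ternary_pol S p \<and> semilattice_or_majority_on p a b"
proof -
  obtain p where p: "ternary_pol S p" "wnu_on p a b"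
    using assms(4) taylor_imp_wnu_on_pair[OF assms(3) _ _ ab] unfolding admits_taylor_def by blast
  show ?thesis
  proof (cases "p a a b = b \<and> p b b a = a")
    case True
    then obtain q where "ternary_pol S q" "wnu_on q a b" "q a a b = a" "q b b a = b"
      using minority_imp_majority[OF assms(1,2) ab p] by blast
    then have "semilattice_or_majority_on q a b" using ab(3) by (simp add: semilattice_or_majority_on_def)
    with \<open>ternary_pol S q\<close> show ?thesis by blast
  qed (use p in \<open>auto simp: semilattice_or_majority_on_def\<close>)
qed

lemma semilattice_or_majority_on_cases:
  assumes "ternary_pol S p" "a \<in> dom S" "b \<in> dom S" "semilattice_or_majority_on p a b"
  obtains
    (semilattice) c where "c = a \<or> c = b" "p a a b = c" "p a b a = c" "p b a a = c"
      "p b b a = c" "p b a b = c" "p a b b = c"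
  | (majority) "p a a b = a" "p a b a = a" "p b a a = a" "p b b a = b" "p b a b = b" "p a b b = b"
  using assms(4) ternary_pol_pair(1,4)[OF assms(1-3)]
  unfolding semilattice_or_majority_on_def wnu_on_def by metis

lemma combine_semilattice_or_majority:
  assumes m: "ternary_pol S m" and q: "ternary_pol S q"
  obtains p where "ternary_pol S p"
    "\<And>a b. a \<in> dom S \<Longrightarrow> b \<in> dom S \<Longrightarrow> a \<noteq> b \<Longrightarrow>
      semilattice_or_majority_on m a b \<or> semilattice_or_majority_on q a b \<Longrightarrow>
      semilattice_or_majority_on p a b"
proof -
  \<comment> \<open>Where \<open>q\<close> is good, \<open>u\<close> is symmetric, hence good or minority; in the latter case \<open>v\<close> is the third
    projection.\<close>
  define u where "u x y z = q (m x y z) (m y z x) (m z x y)" for x y z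
  define v where "v x y z = u x y (u x y z)" for x y z
  define p where "p x y z = q (v x y z) (v y z x) (v z x y)" for x y z
  have up: "ternary_pol S u" unfolding u_def[abs_def]
    by (intro ternary_pol_comp[OF q] ternary_pol_comp[OF m] ternary_pol_proj)
  have vp: "ternary_pol S v" unfolding v_def[abs_def]
    by (intro ternary_pol_comp[OF up] ternary_pol_proj)
  have pp: "ternary_pol S p" unfolding p_def[abs_def]
    by (intro ternary_pol_comp[OF q] ternary_pol_comp[OF vp] ternary_pol_proj)
  show ?thesis
  proof (rule that[OF pp])
    fix a b assume ab: "a \<in> dom S" "b \<in> dom S" "a \<noteq> b"
      and good: "semilattice_or_majority_on m a b \<or> semilattice_or_majority_on q a b"
    note som = semilattice_or_majority_on_def wnu_on_def
    note qv = ternary_pol_pair(7,8)[OF q ab(1,2)] and uv = ternary_pol_pair(7,8)[OF up ab(1,2)]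
    have um: "semilattice_or_majority_on u a b" if "semilattice_or_majority_on m a b"
      using m ab(1,2) that
      by (cases rule: semilattice_or_majority_on_cases) (use qv ab(3) in \<open>auto simp: som u_def\<close>)
    \<comment> \<open>On the pair \<open>q\<close> depends only on how often each value occurs, and
      a cyclic shift of the arguments of \<open>u\<close> merely shifts the inputs of
      \<open>q\<close>.\<close>
    have uq: "wnu_on u a b" if "semilattice_or_majority_on q a b"
      using q ab(1,2) that
    proof (cases rule: semilattice_or_majority_on_cases)
      case (semilattice c)
      show ?thesis
        unfolding wnu_on_def u_def using ternary_pol_pair(1-6)[OF m ab(1,2)]
        by (elim disjE) (simp_all add: semilattice qv)
    next
      case majority
      show ?thesis
        unfolding wnu_on_def u_def using ternary_pol_pair(1-6)[OF m ab(1,2)]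
        by (elim disjE) (simp_all add: majority qv)
    qed
    have vu: "semilattice_or_majority_on v a b" if "semilattice_or_majority_on u a b"
      using up ab(1,2) that
      by (cases rule: semilattice_or_majority_on_cases) (use uv ab(3) in \<open>auto simp: som v_def\<close>)
    have pv: "semilattice_or_majority_on p a b" if "semilattice_or_majority_on v a b"
      using vp ab(1,2) that
      by (cases rule: semilattice_or_majority_on_cases) (use qv ab(3) in \<open>auto simp: som p_def\<close>)
    show "semilattice_or_majority_on p a b"
    proof (cases "semilattice_or_majority_on u a b")
      case False
      then have gq: "semilattice_or_majority_on q a b" using good um by blast
      have "u a a b = b" "u b b a = a" using uq[OF gq] False by (auto simp: som)
      then have "v a a b = b" "v a b a = a" "v b a a = a" "v b b a = a" "v b a b = b" "v a b b = b"
        using uq[OF gq] uv by (simp_all add: wnu_on_def v_def)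
      \<comment> \<open>Hence \<open>p x y z = q z x y\<close> on the pair.\<close>
      then show ?thesis
        using gq by (simp add: som p_def)
    qed (use vu pv in blast)
  qed
qed

text \<open>A polymorphism with the fewest bad pairs has none: combining it with one that is good at
  a bad pair repairs that pair and spoils no other.\<close>

lemma exists_semilattice_or_majority:
  assumes S: "is_rel_struct S" "finite (dom S)" "three_conservative S" "admits_taylor S"
  shows "\<exists>p. ternary_pol S p \<and>
    (\<forall>a \<in> dom S. \<forall>b \<in> dom S. a \<noteq> b \<longrightarrow> semilattice_or_majority_on p a b)"
proof -
  define N where "N p = {(a, b). a \<in> dom S \<and> b \<in> dom S \<and> a \<noteq> b \<and> \<not> semilattice_or_majority_on p a b}" for p
  have finN: "finite (N p)" for p
    by (rule finite_subset[of _ "dom S \<times> dom S"]) (use S(2) in \<open>auto simp: N_def\<close>)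
  obtain m where m: "ternary_pol S m" "\<And>p. ternary_pol S p \<Longrightarrow> card (N m) \<le> card (N p)"
    using ex_has_least_nat[of "ternary_pol S", OF ternary_pol_proj(1), of "\<lambda>t. card (N t)"] by blast
  have "semilattice_or_majority_on m a b" if ab: "a \<in> dom S" "b \<in> dom S" "a \<noteq> b" for a b
  proof (rule ccontr)
    assume bad: "\<not> semilattice_or_majority_on m a b"
    obtain q where q: "ternary_pol S q" "semilattice_or_majority_on q a b"
      using exists_semilattice_or_majority_on_pair[OF S ab] by blast
    obtain p where p: "ternary_pol S p" "\<And>a b. a \<in> dom S \<Longrightarrow> b \<in> dom S \<Longrightarrow> a \<noteq> b \<Longrightarrow>
      semilattice_or_majority_on m a b \<or> semilattice_or_majority_on q a b \<Longrightarrow>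
      semilattice_or_majority_on p a b"
      using combine_semilattice_or_majority[OF m(1) q(1)] by blast
    have "N p \<subseteq> N m" using p(2) by (auto simp: N_def)
    moreover have "(a, b) \<in> N m - N p" using ab bad q(2) p(2) by (auto simp: N_def)
    ultimately have "card (N p) < card (N m)" using finN by (intro psubset_card_mono) auto
    then show False using m(2)[OF p(1)] by simp
  qed
  with m(1) show ?thesis by blast
qed

section \<open>Congruence joins and meet semidistributivity\<close>

text \<open>Being joined by a chain of \<beta>- and \<gamma>-steps is a congruence, since the
  arguments of an operation can be changed one at a time.\<close>

lemma cong_join_subset_rtrancl:
  assumes alg: "is_algebra \<Sigma> B" and \<beta>: "\<beta> \<in> congruences \<Sigma> B" and \<gamma>: "\<gamma> \<in> congruences \<Sigma> B"
  shows "cong_join \<Sigma> B \<beta> \<gamma> \<subseteq> (\<beta> \<union> \<gamma>)\<^sup>*"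
proof -
  let ?U = "univ B" and ?r = "\<beta> \<union> \<gamma>"
  \<comment> \<open>\<open>rtrancl\<close> relates every element of the type to itself, so it is cut
    down to the universe.\<close>
  define \<theta> where "\<theta> = ?r\<^sup>* \<inter> ?U \<times> ?U"
  have eq: "equiv ?U \<beta>" "equiv ?U \<gamma>" using \<beta> \<gamma> by (auto simp: congruences_def)
  have sub: "?r \<subseteq> ?U \<times> ?U" using eq by (auto simp: equiv_def)
  have symr: "sym ?r" using eq by (auto simp: equiv_def intro: sym_Un)
  have equ: "equiv ?U \<theta>"
  proof (rule equivI)
    show "sym \<theta>" using sym_rtrancl[OF symr] by (auto simp: \<theta>_def sym_def)
    show "trans \<theta>" unfolding trans_def \<theta>_def by (auto intro: rtrancl_trans)
  qed (auto simp: \<theta>_def refl_on_def)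
  have one: "(op B f (l @ x # m), op B f (l @ y # m)) \<in> ?r\<^sup>*"
    if f: "f \<in> syms \<Sigma>" and len: "length (l @ x # m) = ar \<Sigma> f" and U: "set l \<subseteq> ?U" "set m \<subseteq> ?U"
      and xy: "(x, y) \<in> ?r\<^sup>*" for f l m x y
    using xy
  proof (induction rule: rtrancl_induct)
    case (step y z)
    have yz: "y \<in> ?U" "z \<in> ?U" using step(2) sub by auto
    have tup: "l @ y # m \<in> tuples (ar \<Sigma> f) ?U" "l @ z # m \<in> tuples (ar \<Sigma> f) ?U"
      using len U yz by (auto simp: tuples_def)
    have "(op B f (l @ y # m), op B f (l @ z # m)) \<in> \<delta>"
      if \<delta>: "\<delta> \<in> congruences \<Sigma> B" and "(y, z) \<in> \<delta>" for \<delta>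
    proof -
      have "refl_on ?U \<delta>" using \<delta> by (auto simp: congruences_def equiv_def)
      then have "list_all2 (\<lambda>x y. (x, y) \<in> \<delta>) k k" if "set k \<subseteq> ?U" for k
        using that by (auto simp: refl_on_def list_all2_same)
      then have "list_all2 (\<lambda>x y. (x, y) \<in> \<delta>) (l @ y # m) (l @ z # m)"
        using U that(2) by (intro list_all2_appendI) auto
      then show ?thesis using \<delta> f tup by (auto simp: congruences_def)
    qed
    then have "(op B f (l @ y # m), op B f (l @ z # m)) \<in> ?r"
      using step(2) \<beta> \<gamma> by blast
    then show ?case using step(3) by (rule rtrancl_into_rtrancl[rotated])
  qed auto
  \<comment> \<open>The prefix \<open>l\<close> holds the arguments already replaced.\<close>
  have all: "(op B f (l @ xs), op B f (l @ ys)) \<in> ?r\<^sup>*"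
    if "f \<in> syms \<Sigma>" "length (l @ xs) = ar \<Sigma> f" "set l \<subseteq> ?U" "set xs \<subseteq> ?U" "set ys \<subseteq> ?U"
      and "list_all2 (\<lambda>x y. (x, y) \<in> ?r\<^sup>*) xs ys" for f l xs ys
    using that(6) that(1-5)
  proof (induction xs ys arbitrary: l rule: list_all2_induct)
    case (Cons x xs y ys)
    have "(op B f (l @ x # xs), op B f (l @ y # xs)) \<in> ?r\<^sup>*"
      using Cons.prems Cons.hyps by (intro one) auto
    moreover have "(op B f ((l @ [y]) @ xs), op B f ((l @ [y]) @ ys)) \<in> ?r\<^sup>*"
      using Cons.prems by (intro Cons.IH) auto
    ultimately show ?case by (auto intro: rtrancl_trans)
  qed auto
  have "\<theta> \<in> congruences \<Sigma> B"
    unfolding congruences_def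
  proof (intro CollectI conjI ballI impI equ)
    fix f xs ys
    assume f: "f \<in> syms \<Sigma>" and xs: "xs \<in> tuples (ar \<Sigma> f) ?U" and ys: "ys \<in> tuples (ar \<Sigma> f) ?U"
      and r: "list_all2 (\<lambda>x y. (x, y) \<in> \<theta>) xs ys"
    have "list_all2 (\<lambda>x y. (x, y) \<in> ?r\<^sup>*) xs ys"
      using r by (rule list_all2_mono) (auto simp: \<theta>_def)
    then show "(op B f xs, op B f ys) \<in> \<theta>"
      using all[of f "[]" xs ys] f xs ys alg by (auto simp: \<theta>_def tuples_def is_algebra_def)
  qed
  moreover have "?r \<subseteq> \<theta>" using sub by (auto simp: \<theta>_def)
  ultimately show ?thesis by (auto simp: cong_join_def \<theta>_def)
qed

text \<open>Let \<open>s(x, y) = g(x, x, y)\<close> and let \<open>(a, b)\<close> lie in \<alpha>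
  and in the join. By walking, \<open>(a, b)\<close> lies in the meet
  \<open>\<alpha> \<inter> \<beta>\<close> as soon as \<open>(s(a, b), s(b, a))\<close> does.
  Identity \<open>comm\<close> secures this for the pair \<open>(a, s(a, b))\<close>, and
  \<open>first\<close> carries it over to \<open>(a, b)\<close>.\<close>

lemma meet_semidistributive_if_wnu:
  assumes alg: "is_algebra \<Sigma> B" and g: "g \<in> syms \<Sigma>" "ar \<Sigma> g = 3"
    and idem: "\<And>x. x \<in> univ B \<Longrightarrow> op B g [x, x, x] = x"
    and wnu: "\<And>x y. x \<in> univ B \<Longrightarrow> y \<in> univ B \<Longrightarrow> op B g [x, y, x] = op B g [x, x, y]"
      "\<And>x y. x \<in> univ B \<Longrightarrow> y \<in> univ B \<Longrightarrow> op B g [y, x, x] = op B g [x, x, y]"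
    and comm: "\<And>x y. x \<in> univ B \<Longrightarrow> y \<in> univ B \<Longrightarrow>
      op B g [x, x, op B g [x, x, y]] = op B g [op B g [x, x, y], op B g [x, x, y], x]"
    and con: "\<alpha> \<in> congruences \<Sigma> B" "\<beta> \<in> congruences \<Sigma> B" "\<gamma> \<in> congruences \<Sigma> B"
    and meet: "\<alpha> \<inter> \<beta> = \<alpha> \<inter> \<gamma>"
  shows "\<alpha> \<inter> cong_join \<Sigma> B \<beta> \<gamma> = \<alpha> \<inter> \<beta>"
proof
  show "\<alpha> \<inter> \<beta> \<subseteq> \<alpha> \<inter> cong_join \<Sigma> B \<beta> \<gamma>" by (auto simp: cong_join_def)
next
  let ?U = "univ B" and ?j = "cong_join \<Sigma> B \<beta> \<gamma>" and ?\<delta> = "\<alpha> \<inter> \<beta>"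
  let ?g = "\<lambda>x y z. op B g [x, y, z]" and ?s = "\<lambda>x y. op B g [x, x, y]"
  have closed: "?g x y z \<in> ?U" if "x \<in> ?U" "y \<in> ?U" "z \<in> ?U" for x y z
    using alg g that by (auto simp: is_algebra_def tuples_def)
  have jc: "?j \<in> congruences \<Sigma> B" by (rule cong_join_in_congruences[OF alg con(2,3)])
  have eqv: "equiv ?U \<theta>" if "\<theta> \<in> congruences \<Sigma> B" for \<theta>
    using that by (simp add: congruences_def)
  have E: "x \<in> ?U \<and> y \<in> ?U" "(y, x) \<in> \<theta>" "(y, z) \<in> \<theta> \<Longrightarrow> (x, z) \<in> \<theta>"
    if "\<theta> \<in> congruences \<Sigma> B" "(x, y) \<in> \<theta>" for \<theta> x y z
    using eqv[OF that(1)] that(2) by (auto elim: equivE dest: symD transD)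
  have R: "(x, x) \<in> \<theta>" if "\<theta> \<in> congruences \<Sigma> B" "x \<in> ?U" for \<theta> x
    using eqv[OF that(1)] that(2) by (rule equiv_class_self[simplified])
  have C: "(?g x y z, ?g x' y' z') \<in> \<theta>"
    if "\<theta> \<in> congruences \<Sigma> B" "(x, x') \<in> \<theta>" "(y, y') \<in> \<theta>" "(z, z') \<in> \<theta>" for \<theta> x y z x' y' z'
  proof -
    have "[x, y, z] \<in> tuples (ar \<Sigma> g) ?U" "[x', y', z'] \<in> tuples (ar \<Sigma> g) ?U"
      using E(1)[OF that(1)] that(2-4) g(2) by (auto simp: tuples_def)
    then show ?thesis using that g(1) by (auto simp: congruences_def)
  qed
  \<comment> \<open>For pairs in \<alpha>, lying in \<beta>, in \<gamma> and in the meet are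
    equivalent, so a walk may pass freely between \<beta>- and \<gamma>-steps.\<close>
  have D: "(x, y) \<in> ?\<delta> \<longleftrightarrow> (x, y) \<in> \<alpha> \<and> (x, y) \<in> \<beta>" "(x, y) \<in> ?\<delta> \<longleftrightarrow> (x, y) \<in> \<alpha> \<and> (x, y) \<in> \<gamma>" for x y
    using meet by auto
  have walk: "(p c, q c) \<in> ?\<delta> \<longleftrightarrow> (p d, q d) \<in> ?\<delta>"
    if \<alpha>: "\<And>c. c \<in> ?U \<Longrightarrow> (p c, q c) \<in> \<alpha>"
      and pq: "\<And>\<theta> c d. \<theta> \<in> congruences \<Sigma> B \<Longrightarrow> (c, d) \<in> \<theta> \<Longrightarrow> (p c, p d) \<in> \<theta> \<and> (q c, q d) \<in> \<theta>"
      and cd: "(c, d) \<in> ?j" for p q c d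
  proof -
    have swap: "(p c, q c) \<in> \<theta> \<longleftrightarrow> (p d, q d) \<in> \<theta>"
      if \<theta>: "\<theta> \<in> congruences \<Sigma> B" and "(c, d) \<in> \<theta>" for \<theta> c d
      using pq[OF that] E(2,3)[OF \<theta>] by blast
    have "(c, d) \<in> (\<beta> \<union> \<gamma>)\<^sup>*" using cd cong_join_subset_rtrancl[OF alg con(2,3)] by blast
    then show ?thesis
    proof (induction rule: rtrancl_induct)
      case (step d e)
      have "d \<in> ?U" "e \<in> ?U" using step(2) E(1)[OF con(2)] E(1)[OF con(3)] by auto
      then have "(p d, q d) \<in> ?\<delta> \<longleftrightarrow> (p e, q e) \<in> ?\<delta>"
        using step(2) \<alpha> D swap con(2,3) by (metis Un_iff)
      with step(3) show ?case by simp
    qed simp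
  qed
  \<comment> \<open>The terms \<open>g(x, y, z)\<close> and \<open>s(x, y)\<close>, respectively \<open>s(z, y)\<close>, agree when \<open>x = z\<close>.\<close>
  have first: "(?s a b, a) \<in> ?\<delta> \<longleftrightarrow> (?s b a, ?s a b) \<in> ?\<delta>"
    and second: "(?s a b, ?s b a) \<in> ?\<delta> \<longleftrightarrow> (?s b a, b) \<in> ?\<delta>"
    if ab: "(a, b) \<in> \<alpha>" "(a, b) \<in> ?j" for a b
  proof -
    have U: "a \<in> ?U" "b \<in> ?U" using E(1)[OF con(1) ab(1)] by auto
    have "(?g a c b, ?s a c) \<in> \<alpha>" "(?g a c b, ?s b c) \<in> \<alpha>" if c: "c \<in> ?U" for c
      using C[OF con(1) R[OF con(1) U(1)] R[OF con(1) c] E(2)[OF con(1) ab(1)]]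
        C[OF con(1) ab(1) R[OF con(1) c] R[OF con(1) U(2)]] wnu(1)[OF _ c] U by auto
    moreover have "(?g a c b, ?g a d b) \<in> \<theta> \<and> (?s a c, ?s a d) \<in> \<theta> \<and> (?s b c, ?s b d) \<in> \<theta>"
      if "\<theta> \<in> congruences \<Sigma> B" "(c, d) \<in> \<theta>" for \<theta> c d
      using C[OF that(1)] R[OF that(1)] U that(2) by blast
    \<comment> \<open>The walk runs from \<open>c = a\<close> to \<open>c = b\<close>; its ends are
      \<open>g(a, a, b) = s(a, b)\<close> and, by weak near-unanimity,
      \<open>g(a, b, b) = s(b, a)\<close>.\<close>
    ultimately have w: "(?g a a b, ?s a a) \<in> ?\<delta> \<longleftrightarrow> (?g a b b, ?s a b) \<in> ?\<delta>"
      "(?g a a b, ?s b a) \<in> ?\<delta> \<longleftrightarrow> (?g a b b, ?s b b) \<in> ?\<delta>"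
      using walk[of "\<lambda>c. ?g a c b" "\<lambda>c. ?s a c"] walk[of "\<lambda>c. ?g a c b" "\<lambda>c. ?s b c"] ab(2) by blast+
    then show "(?s a b, a) \<in> ?\<delta> \<longleftrightarrow> (?s b a, ?s a b) \<in> ?\<delta>"
      "(?s a b, ?s b a) \<in> ?\<delta> \<longleftrightarrow> (?s b a, b) \<in> ?\<delta>"
      using idem U wnu(2)[of b a] by auto
  qed
  have S: "(y, x) \<in> ?\<delta>" if "(x, y) \<in> ?\<delta>" for x y using that E(2) con(1,2) by blast
  have T: "(x, z) \<in> ?\<delta>" if "(x, y) \<in> ?\<delta>" "(y, z) \<in> ?\<delta>" for x y z using that E(3) con(1,2) by blast
  have collapse: "(a, b) \<in> ?\<delta>" if "(a, b) \<in> \<alpha>" "(a, b) \<in> ?j" "(?s a b, ?s b a) \<in> ?\<delta>" for a b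
    using first[OF that(1,2)] second[OF that(1,2)] that(3) S T by blast
  show "\<alpha> \<inter> ?j \<subseteq> ?\<delta>"
  proof (rule subrelI)
    fix a b assume "(a, b) \<in> \<alpha> \<inter> ?j"
    then have ab: "(a, b) \<in> \<alpha>" "(a, b) \<in> ?j" by auto
    have U: "a \<in> ?U" "b \<in> ?U" using E(1)[OF con(1) ab(1)] by auto
    have *: "(a, ?s a b) \<in> \<theta>" if "\<theta> \<in> congruences \<Sigma> B" "(a, b) \<in> \<theta>" for \<theta>
      using C[OF that(1) R[OF that(1) U(1)] R[OF that(1) U(1)] that(2)] idem[OF U(1)] by simp
    \<comment> \<open>By \<open>*\<close> the pair \<open>(a, s(a, b))\<close> lies in \<alpha> and
      in the join; by \<open>comm\<close> the two elements that \<open>collapse\<close> compares are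
      equal.\<close>
    have "(?s a (?s a b), ?s (?s a b) a) \<in> ?\<delta>"
      using comm[OF U] R[of _ "?s a (?s a b)"] closed U con(1,2) by auto
    then have "(a, ?s a b) \<in> ?\<delta>"
      using *[OF con(1) ab(1)] *[OF jc ab(2)] by (rule collapse[rotated 2])
    then show "(a, b) \<in> ?\<delta>" using first[OF ab] S collapse[OF ab] by blast
  qed
qed

section \<open>Transfer of identities to the generated variety\<close>

theorem theorem8:
  fixes S :: "('i, 'a) rel_struct"
  assumes "is_rel_struct S"
    and "finite (dom S)"
    and "three_conservative S"
    and "\<forall>i \<in> idx S. rel_ar S i \<in> {1, 2}"
    and "admits_taylor S"
  shows "congruence_meet_semidistributive (pol_sig S)
    (generated_variety (pol_sig S) (pol_alg S) :: ('a opn, 'b) alg set)"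
proof -
  obtain p where p: "ternary_pol S p"
    "\<And>a b. a \<in> dom S \<Longrightarrow> b \<in> dom S \<Longrightarrow> a \<noteq> b \<Longrightarrow> semilattice_or_majority_on p a b"
    using exists_semilattice_or_majority[OF assms(1-3,5)] by blast
  define g where "g = (3::nat, \<lambda>xs \<in> tuples 3 (dom S). p (xs ! 0) (xs ! 1) (xs ! 2))"
  have g: "g \<in> Pol S" unfolding g_def by (rule ternary_pol_imp_Pol[OF assms(1,4) p(1)])
  have gp: "snd g [x, y, z] = p x y z" if "x \<in> dom S" "y \<in> dom S" "z \<in> dom S" for x y z
    using that by (simp add: g_def tuples_def)
  have ar: "g \<in> syms (pol_sig S)" "ar (pol_sig S) g = 3" using g by (auto simp: pol_sig_def g_def)
  let ?t = "\<lambda>x y z. App g [x, y, z]" and ?x = "Var (0::nat)" and ?y = "Var (1::nat)"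
  let ?s = "?t ?x ?x ?y"
  have idem: "p x x x = x" if "x \<in> dom S" for x
    using ternary_pol_pair(7)[OF p(1) that that] .
  \<comment> \<open>In the last identity both sides are the common value on a semilattice pair and
    \<open>x\<close> on a majority pair; a minority would give \<open>y\<close> and
    \<open>x\<close>.\<close>
  have val: "p x y x = p x x y \<and> p y x x = p x x y \<and> p x x (p x x y) = p (p x x y) (p x x y) x"
    if d: "x \<in> dom S" "y \<in> dom S" for x y
  proof (cases "x = y")
    case False
    from p(1) d p(2)[OF d False] show ?thesis
      by (cases rule: semilattice_or_majority_on_cases) (use idem d in auto)
  qed (use idem d in simp)
  have ids: "satisfies_id (pol_alg S) (?t ?x ?x ?x) ?x"
    "satisfies_id (pol_alg S) (?t ?x ?y ?x) ?s" "satisfies_id (pol_alg S) (?t ?y ?x ?x) ?s"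
    "satisfies_id (pol_alg S) (?t ?x ?x ?s) (?t ?s ?s ?x)"
    using val idem ternary_pol_dom[OF p(1)] unfolding satisfies_id_def
    by (auto simp: pol_alg_def gp image_subset_iff)
  have "\<alpha> \<inter> cong_join (pol_sig S) B \<beta> \<gamma> = \<alpha> \<inter> \<beta>"
    if B: "B \<in> generated_variety (pol_sig S) (pol_alg S)"
      and con: "\<alpha> \<in> congruences (pol_sig S) B" "\<beta> \<in> congruences (pol_sig S) B" "\<gamma> \<in> congruences (pol_sig S) B"
      and meet: "\<alpha> \<inter> \<beta> = \<alpha> \<inter> \<gamma>" for B :: "('a opn, 'b) alg" and \<alpha> \<beta> \<gamma>
  proof -
    \<comment> \<open>All identities involved use only the variables 0 and 1, so sending 0 to
      \<open>x\<close> and every other variable to \<open>y\<close> evaluates them.\<close>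
    have transfer: "trm_val B (\<lambda>n. if n = 0 then x else y) s = trm_val B (\<lambda>n. if n = 0 then x else y) t"
      if "satisfies_id (pol_alg S) s t" "wf_trm (pol_sig S) s" "wf_trm (pol_sig S) t" "x \<in> univ B" "y \<in> univ B"
      for s t x y
    proof -
      have "satisfies_id B s t" using B that(1-3) by (simp add: generated_variety_def)
      moreover have "range (\<lambda>n. if n = (0::nat) then x else y) \<subseteq> univ B" using that(4,5) by auto
      ultimately show ?thesis by (simp only: satisfies_id_def)
    qed
    show ?thesis
    proof (rule meet_semidistributive_if_wnu[OF _ ar _ _ _ _ con meet])
      show "is_algebra (pol_sig S) B" using B by (simp add: generated_variety_def)
    next
      fix x assume "x \<in> univ B"
      then show "op B g [x, x, x] = x"
        using transfer[OF ids(1), of x x] ar by simp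
    next
      fix x y assume "x \<in> univ B" "y \<in> univ B"
      then show "op B g [x, y, x] = op B g [x, x, y]" "op B g [y, x, x] = op B g [x, x, y]"
        "op B g [x, x, op B g [x, x, y]] = op B g [op B g [x, x, y], op B g [x, x, y], x]"
        using transfer[OF ids(2), of x y] transfer[OF ids(3), of x y] transfer[OF ids(4), of x y] ar
        by simp_all
    qed
  qed
  then show ?thesis unfolding congruence_meet_semidistributive_def by (intro ballI impI)
qed

end
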